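(* Let $Q_1,\dots,Q_N\in\mathbb{R}^{n\times n}$ be symmetric positive definite matrices (the scenarios, $N=|\mathcal{S}|$), let $f(x,Q)=x^\top Qx$, and let $1\le K\le N$. For all sufficiently large $M>0$, the problem of computing matrix clusters $\mathcal{S}_1,\dots,\mathcal{S}_K$ and representatives $\tilde Q_1,\dots,\tilde Q_K$ that minimize the approximation guarantee $\alpha\beta$ for the reduced DRO problem (as defined in the context) can be formulated as $$\begin{aligned}\min_{\alpha,\beta,\tilde Q,z}\quad&\alpha\beta\\ \text{s.t.}\quad& Q_i\preceq\alpha\tilde Q_j+M(1-z_{ij})I\quad\forall i=1,\dots,N,\ j=1,\dots,K,\\ &\tilde Q_j\preceq\beta Q_i+M(1-z_{ij})I\quad\forall i=1,\dots,N,\ j=1,\dots,K,\\ &\sum_{j=1}^K z_{ij}=1\quad\forall i=1,\dots,N,\\ &\sum_{i=1}^N z_{ij}\ge1\quad\forall j=1,\dots,K,\\ &\alpha,\beta\ge0,\ \tilde Q_j\succeq0\ \forall j,\ z_{ij}\in\{0,1\}\ \forall i,j.\end{aligned}$$ That is: the optimal value of this program equals the minimum of $\alpha\beta$ over all admissible tuples, and for every optimal solution $(\alpha,\beta,\tilde Q,z)$ the clusters $\mathcal{S}_j=\{Q_i: z_{ij}=1\}$ together with the representatives $\tilde Q_j$ and $(\alpha,\beta)$ form an admissible tuple attaining that minimum. Here, for every admissible tuple, $\alpha\beta$ is an approximation guarantee for the reduced DRO problem: for every $\mathcal{X}\subseteq\mathbb{R}^n$ and every nonempty ambiguity set $\mathcal{P}$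 of probability vectors in $[0,1]^N$, if $x^*\in\mathcal{X}$ is an optimal solution of the original DRO problem and $\tilde x\in\mathcal{X}$ is an optimal solution of the reduced DRO problem, then $$\sup_{p\in\mathcal{P}}\sum_{i=1}^N p_i f(\tilde x,Q_i)\le\alpha\beta\sup_{p\in\mathcal{P}}\sum_{i=1}^N p_i f(x^*,Q_i).$$
   Context: $\preceq$ denotes the Loewner order: $A\preceq B$ iff $B-A$ is positive semidefinite; $I$ is the $n\times n$ identity matrix. The matrices $\tilde Q_j$ range over symmetric $n\times n$ matrices. An admissible tuple consists of a partition of the (indexed) scenario set $\mathcal{S}=\{Q_1,\dots,Q_N\}$ into $K$ nonempty pairwise disjoint clusters $\mathcal{S}_1,\dots,\mathcal{S}_K$, symmetric positive semidefinite representatives $\tilde Q_1,\dots,\tilde Q_K$, and scalars $\alpha,\beta>0$ such that for every $j$ and every $Q_i\in\mathcal{S}_j$: $Q_i\preceq\alpha\tilde Q_j$ and $\tilde Q_j\preceq\beta Q_i$. The original DRO problem is $\inf_{x\in\mathcal{X}}\sup_{p\in\mathcal{P}}\sum_{i=1}^N p_i f(x,Q_i)$. For a given partition and representatives, the reduced DRO problem is $\inf_{x\in\mathcal{X}}\sup_{\tilde p\in\tilde{\mathcal{P}}}\sum_{j=1}^K\tilde p_j f(x,\tilde Q_j)$ with the aggregated ambiguity set $\tilde{\mathcal{P}}=\{\tilde p\in[0,1]^K:\ \tilde p_j=\sum_{i:\,Q_i\in\mathcal{S}_j}p_i,\ p\in\mathcal{P}\}$. *)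

theory Defs
  imports "HOL-Analysis.Analysis"
begin

text \<open>
  Scenarios are indexed by a finite type \<open>'s\<close> (so \<open>N = CARD('s)\<close>) and clusters by a finite
  type \<open>'k\<close> (so \<open>K = CARD('k)\<close>). A cluster is a set of scenario indices, so equal matrices with
  different indices may lie in different clusters.
\<close>

definition pos_semidef :: "real^'n^'n \<Rightarrow> bool" where
  "pos_semidef A \<longleftrightarrow> transpose A = A \<and> (\<forall>x. 0 \<le> x \<bullet> (A *v x))"

definition pos_def :: "real^'n^'n \<Rightarrow> bool" where
  "pos_def A \<longleftrightarrow> transpose A = A \<and> (\<forall>x. x \<noteq> 0 \<longrightarrow> 0 < x \<bullet> (A *v x))"

definition loewner_le :: "real^'n^'n \<Rightarrow> real^'n^'n \<Rightarrow> bool" (infix "\<preceq>\<^sub>L" 50) where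
  "A \<preceq>\<^sub>L B \<longleftrightarrow> pos_semidef (B - A)"

definition admissible ::
  "('s::finite \<Rightarrow> real^'n^'n) \<Rightarrow> ('k::finite \<Rightarrow> 's set) \<Rightarrow> ('k \<Rightarrow> real^'n^'n)
    \<Rightarrow> real \<Rightarrow> real \<Rightarrow> bool" where
  "admissible Q S Qt \<alpha> \<beta> \<longleftrightarrow>
     (\<Union>j. S j) = UNIV \<and> disjoint_family S \<and> (\<forall>j. S j \<noteq> {}) \<and>
     (\<forall>j. pos_semidef (Qt j)) \<and> \<alpha> > 0 \<and> \<beta> > 0 \<and>
     (\<forall>j. \<forall>i\<in>S j. Q i \<preceq>\<^sub>L \<alpha> *\<^sub>R Qt j \<and> Qt j \<preceq>\<^sub>L \<beta> *\<^sub>R Q i)"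

definition program_feasible ::
  "('s::finite \<Rightarrow> real^'n^'n) \<Rightarrow> real \<Rightarrow> real \<Rightarrow> real \<Rightarrow> ('k::finite \<Rightarrow> real^'n^'n)
    \<Rightarrow> ('s \<Rightarrow> 'k \<Rightarrow> real) \<Rightarrow> bool" where
  "program_feasible Q M \<alpha> \<beta> Qt z \<longleftrightarrow>
     (\<forall>i j. Q i \<preceq>\<^sub>L \<alpha> *\<^sub>R Qt j + (M * (1 - z i j)) *\<^sub>R mat 1) \<and>
     (\<forall>i j. Qt j \<preceq>\<^sub>L \<beta> *\<^sub>R Q i + (M * (1 - z i j)) *\<^sub>R mat 1) \<and>
     (\<forall>i. (\<Sum>j\<in>UNIV. z i j) = 1) \<and>
     (\<forall>j. (\<Sum>i\<in>UNIV. z i j) \<ge> 1) \<and>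
     \<alpha> \<ge> 0 \<and> \<beta> \<ge> 0 \<and> (\<forall>j. pos_semidef (Qt j)) \<and> (\<forall>i j. z i j \<in> {0, 1})"

definition program_optimal ::
  "('s::finite \<Rightarrow> real^'n^'n) \<Rightarrow> real \<Rightarrow> real \<Rightarrow> real \<Rightarrow> ('k::finite \<Rightarrow> real^'n^'n)
    \<Rightarrow> ('s \<Rightarrow> 'k \<Rightarrow> real) \<Rightarrow> bool" where
  "program_optimal Q M \<alpha> \<beta> Qt z \<longleftrightarrow>
     is_arg_min (\<lambda>(\<alpha>, \<beta>, Qt, z). \<alpha> * \<beta>) (\<lambda>(\<alpha>, \<beta>, Qt, z). program_feasible Q M \<alpha> \<beta> Qt z)
       (\<alpha>, \<beta>, Qt, z)"

definition is_minimum :: "real set \<Rightarrow> real \<Rightarrow> bool" where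
  "is_minimum A v \<longleftrightarrow> v \<in> A \<and> (\<forall>w\<in>A. v \<le> w)"

definition quad :: "real^'n \<Rightarrow> real^'n^'n \<Rightarrow> real" where
  "quad x A = x \<bullet> (A *v x)"

definition prob_vectors :: "(real^'i::finite) set" where
  "prob_vectors = {p. (\<forall>i. p $ i \<in> {0..1}) \<and> (\<Sum>i\<in>UNIV. p $ i) = 1}"

text \<open>
  The objective of both DRO problems: the original one with the scenarios and \<open>P\<close>, the reduced
  one with the representatives and \<open>aggregated S P\<close>. For nonempty \<open>P \<subseteq> prob_vectors\<close> these
  suprema are over nonempty bounded sets of reals.
\<close>

definition dro_objective ::
  "('i::finite \<Rightarrow> real^'n^'n) \<Rightarrow> (real^'i) set \<Rightarrow> real^'n \<Rightarrow> real" where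
  "dro_objective Q P x = (SUP p\<in>P. \<Sum>i\<in>UNIV. p $ i * quad x (Q i))"

definition aggregated ::
  "('k::finite \<Rightarrow> 's::finite set) \<Rightarrow> (real^'s) set \<Rightarrow> (real^'k) set" where
  "aggregated S P =
     {pt. (\<forall>j. pt $ j \<in> {0..1}) \<and> (\<exists>p\<in>P. \<forall>j. pt $ j = (\<Sum>i\<in>S j. p $ i))}"

definition dro_optimal ::
  "('i::finite \<Rightarrow> real^'n^'n) \<Rightarrow> (real^'i) set \<Rightarrow> (real^'n) set \<Rightarrow> real^'n \<Rightarrow> bool" where
  "dro_optimal Q P X x \<longleftrightarrow> is_arg_min (dro_objective Q P) (\<lambda>x. x \<in> X) x"

end

theory Submission
  imports Defs
begin

text \<open>
  Rescaling (\<open>\<alpha>\<close>, \<open>\<beta>\<close>, \<open>Qt\<close>) to (\<open>1\<close>, \<open>\<alpha> \<beta>\<close>, \<open>\<alpha> Qt\<close>) preserves admissibility and the product, so a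
  number \<open>v\<close> is attained by an admissible tuple exactly when some partition and representatives
  satisfy \<open>Q\<^sub>i \<preceq> Qt\<^sub>j \<preceq> v Q\<^sub>i\<close> for all \<open>i\<close> in cluster \<open>j\<close>. With \<open>v\<close> bounded, such representatives
  form a compact set, and there are finitely many partitions; hence a least value \<open>v\<close> exists
  (\<open>admissible_minimum_exists\<close>).

  A feasible point of the program is always admissible: constraints with \<open>z\<^sub>i\<^sub>j = 1\<close> are the
  admissibility constraints, and \<open>\<alpha> = 0\<close> or \<open>\<beta> = 0\<close> would force some \<open>Q\<^sub>i \<preceq> 0\<close>
  (\<open>program_feasible_imp_admissible\<close>). Thus the program never goes below the least value. To reach
  it, only one minimizer has to be feasible: the normalized one has \<open>\<alpha> = 1\<close> and representatives
  below \<open>v Q\<^sub>i\<close>, so any \<open>M\<close> that dominates the spectra of the \<open>Q\<^sub>i\<close> and of the \<open>v Q\<^sub>i\<close> makes the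
  constraints with \<open>z\<^sub>i\<^sub>j = 0\<close> hold at this point (\<open>normalized_feasible\<close>). The normalization matters:
  in general no single \<open>M\<close> keeps all rescalings of an admissible tuple feasible.

  For the guarantee, the two Loewner bounds transfer to the worst-case objectives at each fixed
  \<open>x\<close>: the original objective is at most \<open>\<alpha>\<close> times the reduced one, which is at most \<open>\<beta>\<close> times the
  original one. Optimality of the reduced solution links the two points.
\<close>

section \<open>Quadratic forms and the Loewner order\<close>

lemma quad_simps [simp]:
  "quad x (A + B) = quad x A + quad x B"
  "quad x (A - B) = quad x A - quad x B"
  "quad x (c *\<^sub>R A) = c * quad x A"
  "quad x (mat 1) = x \<bullet> x"
  by (simp_all add: quad_def matrix_vector_mult_add_rdistrib matrix_vector_mult_diff_rdistrib
      inner_add_right inner_diff_right scaleR_matrix_vector_assoc[symmetric])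

lemma transpose_simps [simp]:
  fixes A B :: "real^'n^'m"
  shows "transpose (A + B) = transpose A + transpose B"
    "transpose (A - B) = transpose A - transpose B"
    "transpose (c *\<^sub>R A) = c *\<^sub>R transpose A"
  by (simp_all add: transpose_def vec_eq_iff)

lemma pos_semidef_iff: "pos_semidef A \<longleftrightarrow> transpose A = A \<and> (\<forall>x. 0 \<le> quad x A)"
  by (simp add: pos_semidef_def quad_def)

lemma loewner_le_quad: "A \<preceq>\<^sub>L B \<Longrightarrow> quad x A \<le> quad x B"
  by (simp add: loewner_le_def pos_semidef_iff)

lemma loewner_le_iff:
  assumes "transpose A = A" "transpose B = B"
  shows "A \<preceq>\<^sub>L B \<longleftrightarrow> (\<forall>x. quad x A \<le> quad x B)"
  using assms by (simp add: loewner_le_def pos_semidef_iff)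

lemma pos_semidef_add: "pos_semidef A \<Longrightarrow> pos_semidef B \<Longrightarrow> pos_semidef (A + B)"
  by (simp add: pos_semidef_iff)

lemma pos_semidef_upward: "pos_semidef A \<Longrightarrow> A \<preceq>\<^sub>L B \<Longrightarrow> pos_semidef B"
  using pos_semidef_add[of A "B - A"] by (simp add: loewner_le_def)

lemma loewner_le_trans: "A \<preceq>\<^sub>L B \<Longrightarrow> B \<preceq>\<^sub>L C \<Longrightarrow> A \<preceq>\<^sub>L C"
  using pos_semidef_add[of "B - A" "C - B"] by (simp add: loewner_le_def)

lemma pos_semidef_scaleR: "0 \<le> c \<Longrightarrow> pos_semidef A \<Longrightarrow> pos_semidef (c *\<^sub>R A)"
  by (simp add: pos_semidef_iff)

lemma loewner_le_scaleR: "0 \<le> c \<Longrightarrow> A \<preceq>\<^sub>L B \<Longrightarrow> c *\<^sub>R A \<preceq>\<^sub>L c *\<^sub>R B"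
  using pos_semidef_scaleR[of c "B - A"] by (simp add: loewner_le_def scaleR_diff_right)

lemma loewner_le_add: "A \<preceq>\<^sub>L B \<Longrightarrow> pos_semidef C \<Longrightarrow> A \<preceq>\<^sub>L C + B"
  using pos_semidef_add[of C "B - A"] by (simp add: loewner_le_def add_diff_eq)

lemma pos_def_imp_pos_semidef: "pos_def A \<Longrightarrow> pos_semidef A"
  unfolding pos_def_def pos_semidef_def by (metis inner_zero_left less_eq_real_def)

lemma pos_def_quad_pos: "pos_def A \<Longrightarrow> x \<noteq> 0 \<Longrightarrow> 0 < quad x A"
  by (simp add: pos_def_def quad_def)



lemma pos_semidef_mat_1: "pos_semidef (mat 1 :: real^'n^'n)"
  by (simp add: pos_semidef_iff)

lemma continuous_on_quad [continuous_intros]: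
  assumes "continuous_on T f"
  shows "continuous_on T (\<lambda>p. quad x (f p))"
proof -
  have "linear (quad x)"
    by (rule linearI) simp_all
  then have "bounded_linear (quad x)"
    by (simp add: linear_conv_bounded_linear)
  then show ?thesis
    using assms by (rule bounded_linear.continuous_on)
qed

lemma closed_Collect_loewner_le:
  fixes f g :: "'a::t2_space \<Rightarrow> real^'n^'n"
  assumes "continuous_on UNIV f" "continuous_on UNIV g"
  shows "closed {p. f p \<preceq>\<^sub>L g p}"
proof -
  have "linear (transpose :: real^'n^'n \<Rightarrow> _)"
    by (rule linearI) simp_all
  then have "bounded_linear (transpose :: real^'n^'n \<Rightarrow> _)"
    by (simp add: linear_conv_bounded_linear)
  then have "continuous_on UNIV (\<lambda>p. transpose (g p - f p))"
    by (rule bounded_linear.continuous_on) (intro continuous_intros assms)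
  then show ?thesis
    unfolding loewner_le_def pos_semidef_iff using assms
    by (intro closed_Collect_conj closed_Collect_all closed_Collect_le closed_Collect_eq
        continuous_intros)
qed

lemma pos_semidef_entry_le:
  fixes A :: "real^'n^'n"
  assumes A: "pos_semidef A" and le: "A \<preceq>\<^sub>L c *\<^sub>R mat 1"
  shows "\<bar>A $ i $ j\<bar> \<le> c"
proof -
  have entry: "axis k 1 \<bullet> (A *v axis l 1) = A $ k $ l" for k l
    by (simp add: inner_axis_axis matrix_vector_mul_component inner_axis' inner_axis)
  have sym: "A $ j $ i = A $ i $ j"
    using A transpose_def[of A] by (auto simp: pos_semidef_iff vec_eq_iff)
  have diag: "A $ k $ k \<le> c" for k
    using loewner_le_quad[OF le, of "axis k 1"]
    by (simp add: inner_axis_axis) (simp add: quad_def entry)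
  \<comment> \<open>Testing with \<open>e\<^sub>i + e\<^sub>j\<close> and \<open>e\<^sub>i - e\<^sub>j\<close> bounds an off-diagonal entry by the mean of two diagonal ones.\<close>
  have "0 \<le> quad (axis i 1 + axis j 1) A" "0 \<le> quad (axis i 1 - axis j 1) A"
    using A by (auto simp: pos_semidef_iff)
  then have "0 \<le> A $ i $ i + A $ j $ j + 2 * A $ i $ j" "0 \<le> A $ i $ i + A $ j $ j - 2 * A $ i $ j"
    by (simp_all add: quad_def matrix_vector_right_distrib matrix_vector_mult_diff_distrib
        inner_add_left inner_add_right inner_diff_left inner_diff_right entry sym)
  with diag[of i] diag[of j] show ?thesis
    by linarith
qed

lemma norm_le_card_mult:
  fixes x :: "'a::real_normed_vector^'n"
  assumes "\<And>i. norm (x $ i) \<le> c"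
  shows "norm x \<le> real CARD('n) * c"
proof -
  have "norm x \<le> (\<Sum>i\<in>UNIV. norm (x $ i))"
    unfolding norm_vec_def by (rule L2_set_le_sum) simp
  also have "\<dots> \<le> real CARD('n) * c"
    using assms by (intro sum_bounded_above)
  finally show ?thesis .
qed

section \<open>Spectral bounds\<close>

text \<open>
  The least value of the quadratic form on the unit sphere is attained, hence positive, and by
  homogeneity it bounds \<open>A\<close> below; the operator norm bounds \<open>A\<close> above. A single constant for both
  directions keeps the later uses short.
\<close>

lemma pos_def_spectral_bounds:
  fixes A :: "real^'n^'n"
  assumes A: "pos_def A"
  obtains c where "c > 0" "A \<preceq>\<^sub>L c *\<^sub>R mat 1" "mat 1 \<preceq>\<^sub>L c *\<^sub>R A"
proof -
  have symA: "transpose A = A"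
    using A by (simp add: pos_def_def)
  obtain K where K: "K > 0" "\<And>x. norm (A *v x) \<le> norm x * K"
    using bounded_linear.pos_bounded[OF matrix_vector_mul_bounded_linear[of A]] by auto
  have upper: "quad x A \<le> K * (x \<bullet> x)" for x
  proof -
    have "quad x A \<le> norm x * norm (A *v x)"
      unfolding quad_def by (rule norm_cauchy_schwarz)
    also have "\<dots> \<le> norm x * (norm x * K)"
      using K by (intro mult_left_mono) auto
    finally show ?thesis
      by (simp add: dot_square_norm power2_eq_square mult_ac)
  qed
  have "continuous_on (sphere 0 1) (\<lambda>x. quad x A)"
    unfolding quad_def by (intro continuous_intros linear_continuous_on matrix_vector_mul_bounded_linear)
  moreover have "sphere (0 :: real^'n) 1 \<noteq> {}"
    by simp
  ultimately obtain u where u: "u \<in> sphere 0 1" "\<And>y. y \<in> sphere 0 1 \<Longrightarrow> quad u A \<le> quad y A"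
    using continuous_attains_inf[OF compact_sphere] by metis
  define m where "m = quad u A"
  have m: "m > 0"
    unfolding m_def using A u by (intro pos_def_quad_pos) auto
  have lower: "m * (x \<bullet> x) \<le> quad x A" for x
  proof (cases "x = 0")
    case False
    have "m \<le> quad (x /\<^sub>R norm x) A"
      unfolding m_def using False by (intro u) simp
    also have "\<dots> = quad x A / (norm x)\<^sup>2"
      by (simp add: quad_def matrix_vector_mult_scaleR power2_eq_square divide_simps)
    finally show ?thesis
      using False by (simp add: dot_square_norm field_simps)
  qed (simp add: quad_def)
  show ?thesis
  proof
    show "K + 1 / m > 0"
      using K m by (simp add: add_pos_pos)
    have "quad x A \<le> (K + 1 / m) * (x \<bullet> x)" for x
      using upper[of x] m by (simp add: distrib_right add_increasing2)
    then show "A \<preceq>\<^sub>L (K + 1 / m) *\<^sub>R mat 1"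
      using symA by (simp add: loewner_le_iff)
    have "x \<bullet> x \<le> (K + 1 / m) * quad x A" for x
    proof -
      have "0 \<le> quad x A"
        using m by (intro order_trans[OF _ lower]) simp
      then have "0 \<le> K * quad x A"
        using K by simp
      moreover have "x \<bullet> x \<le> quad x A / m"
        using lower[of x] m by (simp add: field_simps)
      ultimately show ?thesis
        by (simp add: distrib_right)
    qed
    then show "mat 1 \<preceq>\<^sub>L (K + 1 / m) *\<^sub>R A"
      using symA by (simp add: loewner_le_iff)
  qed
qed

lemma loewner_le_scaleR_mono:
  assumes "A \<preceq>\<^sub>L c *\<^sub>R B" "c \<le> d" "pos_semidef B"
  shows "A \<preceq>\<^sub>L d *\<^sub>R B"
proof -
  have "A \<preceq>\<^sub>L (d - c) *\<^sub>R B + c *\<^sub>R B"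
    using assms by (intro loewner_le_add pos_semidef_scaleR) auto
  then show ?thesis
    by (simp add: scaleR_left_diff_distrib)
qed

lemma uniform_spectral_bounds:
  fixes Q :: "'s::finite \<Rightarrow> real^'n^'n"
  assumes Q: "\<And>i. pos_def (Q i)"
  obtains c where "c > 0" "\<And>i. Q i \<preceq>\<^sub>L c *\<^sub>R mat 1" "\<And>i. mat 1 \<preceq>\<^sub>L c *\<^sub>R Q i"
proof -
  have "\<forall>i. \<exists>c>0. Q i \<preceq>\<^sub>L c *\<^sub>R mat 1 \<and> mat 1 \<preceq>\<^sub>L c *\<^sub>R Q i"
    using pos_def_spectral_bounds[OF Q] by metis
  then obtain c where c: "\<And>i. c i > 0" "\<And>i. Q i \<preceq>\<^sub>L c i *\<^sub>R mat 1" "\<And>i. mat 1 \<preceq>\<^sub>L c i *\<^sub>R Q i"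
    by metis
  have le: "c i \<le> (\<Sum>i\<in>UNIV. c i)" for i
    using c(1) by (intro member_le_sum) (auto intro: less_imp_le)
  show ?thesis
  proof
    show "(\<Sum>i\<in>UNIV. c i) > 0"
      using c(1) by (intro sum_pos) auto
    show "Q i \<preceq>\<^sub>L (\<Sum>i\<in>UNIV. c i) *\<^sub>R mat 1" for i
      using c(2) le pos_semidef_mat_1 by (rule loewner_le_scaleR_mono)
    show "mat 1 \<preceq>\<^sub>L (\<Sum>i\<in>UNIV. c i) *\<^sub>R Q i" for i
      using c(3) le pos_def_imp_pos_semidef[OF Q] by (rule loewner_le_scaleR_mono)
  qed
qed

section \<open>Normalized tuples and the least guarantee\<close>

text \<open>
  These are the Loewner bounds of an admissible tuple normalized to \<open>\<alpha> = 1\<close>. For positive definite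
  \<open>Q\<close> and nonempty clusters they imply that \<open>v\<close> is positive and the representatives are positive
  semidefinite; being closed conditions, they suit the compactness argument.
\<close>

definition sandwiched ::
  "('s \<Rightarrow> real^'n^'n) \<Rightarrow> ('k \<Rightarrow> 's set) \<Rightarrow> ('k \<Rightarrow> real^'n^'n) \<Rightarrow> real \<Rightarrow> bool" where
  "sandwiched Q S R v \<longleftrightarrow> (\<forall>j. \<forall>i\<in>S j. Q i \<preceq>\<^sub>L R j \<and> R j \<preceq>\<^sub>L v *\<^sub>R Q i)"

definition clustering :: "('k \<Rightarrow> 's set) \<Rightarrow> bool" where
  "clustering S \<longleftrightarrow> (\<Union>j. S j) = UNIV \<and> disjoint_family S \<and> (\<forall>j. S j \<noteq> {})"

lemma sandwiched_pos_semidef: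
  assumes "sandwiched Q S R v" "S j \<noteq> {}" "\<And>i. pos_def (Q i)"
  shows "pos_semidef (R j)"
proof -
  obtain i where "Q i \<preceq>\<^sub>L R j"
    using assms by (auto simp: sandwiched_def)
  then show ?thesis
    using assms(3) pos_def_imp_pos_semidef pos_semidef_upward by blast
qed

text \<open>Transitivity gives \<open>Q\<^sub>i \<preceq> v Q\<^sub>i\<close>, which is impossible for \<open>v \<le> 0\<close>.\<close>

lemma sandwiched_value_pos:
  fixes Q :: "'s \<Rightarrow> real^'n^'n"
  assumes "sandwiched Q S R v" "S j \<noteq> {}" "\<And>i. pos_def (Q i)"
  shows "v > 0"
proof -
  obtain i where i: "Q i \<preceq>\<^sub>L v *\<^sub>R Q i"
    using assms unfolding sandwiched_def by (meson ex_in_conv loewner_le_trans)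
  obtain x :: "real^'n" where "x \<noteq> 0"
    by (metis one_neq_zero)
  with assms(3) have "0 < quad x (Q i)"
    by (rule pos_def_quad_pos)
  moreover have "quad x (Q i) \<le> v * quad x (Q i)"
    using loewner_le_quad[OF i] by simp
  ultimately show ?thesis
    by (smt (verit) zero_less_mult_iff)
qed

lemma sandwiched_imp_admissible:
  fixes S :: "'k::finite \<Rightarrow> 's::finite set"
  assumes "sandwiched Q S R v" "clustering S" "\<And>i. pos_def (Q i)"
  shows "admissible Q S R 1 v"
  using assms sandwiched_pos_semidef[OF assms(1)] sandwiched_value_pos[OF assms(1)]
  unfolding admissible_def clustering_def by (auto simp: sandwiched_def)

text \<open>The rescaling that moves \<open>\<alpha>\<close> into the representatives and leaves the product unchanged.\<close>

lemma admissible_imp_sandwiched: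
  assumes "admissible Q S Qt \<alpha> \<beta>"
  shows "sandwiched Q S (\<lambda>j. \<alpha> *\<^sub>R Qt j) (\<alpha> * \<beta>)" "clustering S"
  using assms loewner_le_scaleR[of \<alpha>]
  by (fastforce simp: admissible_def sandwiched_def clustering_def simp flip: scaleR_scaleR)+

text \<open>
  An injection from clusters to scenarios exists by cardinality; the fibres of its left inverse
  are nonempty and partition the scenarios.
\<close>

lemma clustering_exists:
  assumes "CARD('k::finite) \<le> CARD('s::finite)"
  shows "\<exists>S :: 'k \<Rightarrow> 's set. clustering S"
proof -
  obtain g :: "'k \<Rightarrow> 's" where g: "inj g"
    using assms by (metis card_le_inj finite inj_on_def UNIV_I)
  have "clustering (\<lambda>j. {i. inv g i = j})"
    using g by (auto simp: clustering_def disjoint_family_on_def intro: inv_f_f)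
  then show ?thesis
    by blast
qed

text \<open>
  The representatives are taken as a vector of matrices, so that a bounded closed set of them is
  compact; the two sides of the sandwich give closedness, and its upper side gives boundedness.
\<close>

lemma compact_sandwiched:
  fixes Q :: "'s::finite \<Rightarrow> real^'n^'n" and S :: "'k::finite \<Rightarrow> 's set"
  assumes Q: "\<And>i. pos_def (Q i)" and S: "clustering S"
  shows "compact {(v, R :: real^'n^'n^'k). v \<le> w \<and> sandwiched Q S (($) R) v}" (is "compact ?C")
proof -
  obtain c where c: "c > 0" "\<And>i. Q i \<preceq>\<^sub>L c *\<^sub>R mat 1"
    using uniform_spectral_bounds[of Q, OF Q] by metis
  have "?C = {p. fst p \<le> w} \<inter>
     (\<Inter>j. \<Inter>i\<in>S j. {p. Q i \<preceq>\<^sub>L snd p $ j} \<inter> {p. snd p $ j \<preceq>\<^sub>L fst p *\<^sub>R Q i})"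
    by (auto simp: sandwiched_def)
  also have "closed \<dots>"
    by (intro closed_Int closed_INT ballI closed_Collect_le closed_Collect_loewner_le
        continuous_intros)
  finally have "closed ?C" .
  moreover have "bounded ?C"
  proof (rule bounded_subset)
    show "bounded ({0..w} \<times> cball (0 :: real^'n^'n^'k)
        (real CARD('k) * (real CARD('n) * (real CARD('n) * (w * c)))))"
      by (intro bounded_Times) auto
    have "0 \<le> v \<and> norm R \<le> real CARD('k) * (real CARD('n) * (real CARD('n) * (w * c)))"
      if "v \<le> w" and R: "sandwiched Q S (($) R) v" for v and R :: "real^'n^'n^'k"
    proof
      have ne: "S j \<noteq> {}" for j
        using S by (simp add: clustering_def)
      show v: "0 \<le> v"
        using sandwiched_value_pos[OF R ne Q] by simp
      have "R $ j \<preceq>\<^sub>L (w * c) *\<^sub>R mat 1" for j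
      proof -
        obtain i where "R $ j \<preceq>\<^sub>L v *\<^sub>R Q i"
          using R ne[of j] by (auto simp: sandwiched_def)
        moreover have "v *\<^sub>R Q i \<preceq>\<^sub>L (v * c) *\<^sub>R mat 1"
          using loewner_le_scaleR[OF v c(2)] by simp
        moreover have "v * c \<le> w * c"
          using that c by simp
        ultimately show ?thesis
          by (meson loewner_le_trans loewner_le_scaleR_mono pos_semidef_mat_1)
      qed
      then have "norm (R $ j $ i $ l) \<le> w * c" for j i l
        using pos_semidef_entry_le[OF sandwiched_pos_semidef[OF R ne Q]] by simp
      then show "norm R \<le> real CARD('k) * (real CARD('n) * (real CARD('n) * (w * c)))"
        by (intro norm_le_card_mult)
    qed
    then show "?C \<subseteq> {0..w} \<times> cball 0 (real CARD('k) * (real CARD('n) * (real CARD('n) * (w * c))))"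
      by auto
  qed
  ultimately show ?thesis
    by (simp add: compact_eq_bounded_closed)
qed

text \<open>
  Minimizing the first coordinate over the compact set of normalized tuples, united over the
  finitely many partitions, gives the least guarantee.
\<close>

lemma admissible_minimum_exists:
  fixes Q :: "'s::finite \<Rightarrow> real^'n^'n"
  assumes Q: "\<And>i. pos_def (Q i)" and card: "CARD('k::finite) \<le> CARD('s)"
  obtains v S and R :: "'k::finite \<Rightarrow> real^'n^'n" where
    "sandwiched Q S R v" and "clustering S" and
    "is_minimum {\<alpha> * \<beta> |\<alpha> \<beta> (Qt :: 'k \<Rightarrow> real^'n^'n) S. admissible Q S Qt \<alpha> \<beta>} v"
proof -
  obtain c where c: "c > 0" "\<And>i. Q i \<preceq>\<^sub>L c *\<^sub>R mat 1" "\<And>i. mat 1 \<preceq>\<^sub>L c *\<^sub>R Q i"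
    using uniform_spectral_bounds[of Q, OF Q] by metis
  \<comment> \<open>Taking every representative equal to \<open>c I\<close> is sandwiched with value \<open>c\<^sup>2\<close>, so it suffices to
      minimize over values up to \<open>c\<^sup>2\<close>.\<close>
  define C where "C = (\<Union>S \<in> {S :: 'k \<Rightarrow> 's set. clustering S}.
    {(v, R :: real^'n^'n^'k). v \<le> c\<^sup>2 \<and> sandwiched Q S (($) R) v})"
  obtain S0 :: "'k \<Rightarrow> 's set" where S0: "clustering S0"
    using clustering_exists[OF card] by blast
  have "c *\<^sub>R mat 1 \<preceq>\<^sub>L c\<^sup>2 *\<^sub>R Q i" for i
    using loewner_le_scaleR[OF _ c(3), of c i] c(1) by (simp add: power2_eq_square)
  then have "sandwiched Q S0 (($) (\<chi> j. c *\<^sub>R mat 1)) (c\<^sup>2)"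
    using c by (simp add: sandwiched_def)
  then have "(c\<^sup>2, \<chi> j. c *\<^sub>R mat 1) \<in> C"
    using S0 unfolding C_def by auto
  moreover have "compact C"
    unfolding C_def using compact_sandwiched[OF Q] by (intro compact_UN) auto
  ultimately obtain p where p: "p \<in> C" "\<And>q. q \<in> C \<Longrightarrow> fst p \<le> fst q"
    using continuous_attains_inf[of C fst] continuous_on_fst[OF continuous_on_id] by (metis empty_iff)
  obtain v R where "p = (v, R)"
    by (cases p)
  with p obtain S where S: "clustering S" "v \<le> c\<^sup>2" "sandwiched Q S (($) R) v"
    and min: "\<And>q. q \<in> C \<Longrightarrow> v \<le> fst q"
    by (auto simp: C_def)
  have "v \<le> \<alpha> * \<beta>" if adm: "admissible Q S' Qt \<alpha> \<beta>"
    for \<alpha> \<beta> and Qt :: "'k \<Rightarrow> real^'n^'n" and S'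
  proof (cases "\<alpha> * \<beta> \<le> c\<^sup>2")
    case True
    have "(($) (\<chi> j. \<alpha> *\<^sub>R Qt j)) = (\<lambda>j. \<alpha> *\<^sub>R Qt j)"
      by auto
    with True admissible_imp_sandwiched[OF adm] have "(\<alpha> * \<beta>, \<chi> j. \<alpha> *\<^sub>R Qt j) \<in> C"
      by (auto simp: C_def)
    from min[OF this] show ?thesis
      by simp
  qed (use S in simp)
  moreover have "\<exists>\<alpha> \<beta> (Qt :: 'k \<Rightarrow> real^'n^'n) S. v = \<alpha> * \<beta> \<and> admissible Q S Qt \<alpha> \<beta>"
    using sandwiched_imp_admissible[OF S(3,1) Q] by (metis mult_1)
  ultimately show ?thesis
    using that[OF S(3,1)] by (auto simp: is_minimum_def)
qed

section \<open>The big-M program\<close>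

text \<open>
  The row sums make the binary \<open>z\<close> the indicator of a partition and the column sums make its parts
  nonempty. Since \<open>Q\<^sub>i \<preceq> \<alpha> Qt\<^sub>j\<close> and \<open>Qt\<^sub>j \<preceq> \<beta> Q\<^sub>i\<close> with \<open>Q\<^sub>i\<close> positive definite, neither factor vanishes,
  so the weak sign constraints of the program lose nothing.
\<close>

lemma program_feasible_imp_admissible:
  fixes Q :: "'s::finite \<Rightarrow> real^'n^'n" and Qt :: "'k::finite \<Rightarrow> real^'n^'n"
  assumes Q: "\<And>i. pos_def (Q i)" and feas: "program_feasible Q M \<alpha> \<beta> Qt z"
  shows "admissible Q (\<lambda>j. {i. z i j = 1}) Qt \<alpha> \<beta>"
proof -
  have z01: "z i j = 0 \<or> z i j = 1" and row: "(\<Sum>j\<in>UNIV. z i j) = 1"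
    and col: "(\<Sum>i\<in>UNIV. z i j) \<ge> 1" for i j
    using feas by (auto simp: program_feasible_def)
  have active: "Q i \<preceq>\<^sub>L \<alpha> *\<^sub>R Qt j" "Qt j \<preceq>\<^sub>L \<beta> *\<^sub>R Q i" if "z i j = 1" for i j
  proof -
    have "Q i \<preceq>\<^sub>L \<alpha> *\<^sub>R Qt j + (M * (1 - z i j)) *\<^sub>R mat 1"
      "Qt j \<preceq>\<^sub>L \<beta> *\<^sub>R Q i + (M * (1 - z i j)) *\<^sub>R mat 1"
      using feas unfolding program_feasible_def by blast+
    with that show "Q i \<preceq>\<^sub>L \<alpha> *\<^sub>R Qt j" "Qt j \<preceq>\<^sub>L \<beta> *\<^sub>R Q i"
      by simp_all
  qed
  have covered: "\<exists>j. z i j = 1" for i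
  proof (rule ccontr)
    assume "\<nexists>j. z i j = 1"
    then have "z i j = 0" for j
      using z01 by blast
    with row[of i] show False
      by simp
  qed
  have nonempty: "\<exists>i. z i j = 1" for j
  proof (rule ccontr)
    assume "\<nexists>i. z i j = 1"
    then have "z i j = 0" for i
      using z01 by blast
    with col[of j] show False
      by simp
  qed
  have unique: "j = l" if "z i j = 1" "z i l = 1" for i j l
  proof (rule ccontr)
    assume "j \<noteq> l"
    then have "2 = (\<Sum>j\<in>{j, l}. z i j)"
      using that by simp
    also have "\<dots> \<le> (\<Sum>j\<in>UNIV. z i j)"
      using z01 by (intro sum_mono2) (auto, metis order_refl zero_le_one)
    finally show False
      using row[of i] by simp
  qed
  have nonneg: "\<alpha> \<ge> 0" "\<beta> \<ge> 0" and psd: "\<And>j. pos_semidef (Qt j)"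
    using feas by (auto simp: program_feasible_def)
  obtain i j where "z i j = 1"
    using nonempty by blast
  obtain x :: "real^'n" where "x \<noteq> 0"
    by (metis one_neq_zero)
  have "0 < quad x (Q i)"
    using Q \<open>x \<noteq> 0\<close> by (rule pos_def_quad_pos)
  then have "0 < \<alpha> * quad x (Qt j)" "quad x (Qt j) \<le> \<beta> * quad x (Q i)"
    using loewner_le_quad[OF active(1)[OF \<open>z i j = 1\<close>], of x]
      loewner_le_quad[OF active(2)[OF \<open>z i j = 1\<close>], of x] by auto
  then have "\<alpha> \<noteq> 0" "\<beta> \<noteq> 0"
    using nonneg by (auto simp: zero_less_mult_iff)
  with nonneg have "\<alpha> > 0" "\<beta> > 0"
    by auto
  with covered nonempty active psd show ?thesis
    unfolding admissible_def disjoint_family_on_def by (auto dest: unique)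
qed

text \<open>
  A representative lies below some \<open>v Q\<^sub>i\<close>, so it and all the scenarios lie below \<open>M I\<close>. Outside the
  clusters the right-hand sides are \<open>M I\<close> plus a positive semidefinite matrix.
\<close>

lemma normalized_feasible:
  fixes Q :: "'s::finite \<Rightarrow> real^'n^'n" and R :: "'k::finite \<Rightarrow> real^'n^'n"
  assumes Q: "\<And>i. pos_def (Q i)" and R: "sandwiched Q S R v" and S: "clustering S"
    and QM: "\<And>i. Q i \<preceq>\<^sub>L M *\<^sub>R mat 1" and vQM: "\<And>i. v *\<^sub>R Q i \<preceq>\<^sub>L M *\<^sub>R mat 1"
  shows "program_feasible Q M 1 v R (\<lambda>i j. of_bool (i \<in> S j))"
proof -
  have ne: "S j \<noteq> {}" for j
    using S by (simp add: clustering_def)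
  have v: "v > 0"
    using sandwiched_value_pos[OF R ne Q] .
  have psdR: "pos_semidef (R j)" for j
    using sandwiched_pos_semidef[OF R ne Q] .
  have psdQ: "pos_semidef (v *\<^sub>R Q i)" for i
    using v Q by (simp add: pos_semidef_scaleR pos_def_imp_pos_semidef)
  have RM: "R j \<preceq>\<^sub>L M *\<^sub>R mat 1" for j
    using R ne[of j] vQM unfolding sandwiched_def by (meson ex_in_conv loewner_le_trans)
  have "Q i \<preceq>\<^sub>L 1 *\<^sub>R R j + (M * (1 - of_bool (i \<in> S j))) *\<^sub>R mat 1" for i j
    using R loewner_le_add[OF QM psdR] by (cases "i \<in> S j") (auto simp: sandwiched_def)
  moreover have "R j \<preceq>\<^sub>L v *\<^sub>R Q i + (M * (1 - of_bool (i \<in> S j))) *\<^sub>R mat 1" for i j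
    using R loewner_le_add[OF RM psdQ] by (cases "i \<in> S j") (auto simp: sandwiched_def)
  moreover have "(\<Sum>j\<in>UNIV. of_bool (i \<in> S j) :: real) = 1" for i
  proof -
    obtain j where j: "i \<in> S j"
      using S by (auto simp: clustering_def)
    then have "(i \<in> S l) = (l = j)" for l
      using S by (auto simp: clustering_def disjoint_family_on_def)
    then show ?thesis
      by simp
  qed
  moreover have "(\<Sum>i\<in>UNIV. of_bool (i \<in> S j) :: real) \<ge> 1" for j
  proof -
    obtain i where "i \<in> S j"
      using ne[of j] by blast
    then show ?thesis
      using member_le_sum[of i UNIV "\<lambda>i. of_bool (i \<in> S j) :: real"] by simp
  qed
  ultimately show ?thesis
    unfolding program_feasible_def using v psdR by (auto simp: of_bool_def)
qed

section \<open>The approximation guarantee\<close>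

text \<open>
  Both directions of the comparison between the original and the reduced problem are instances of
  this domination principle. The supremum on the right must be over a bounded set, which is where
  probability vectors enter.
\<close>

lemma dro_objective_mono:
  fixes Q :: "'i::finite \<Rightarrow> real^'n^'n" and Q' :: "'l::finite \<Rightarrow> real^'n^'n"
  assumes "P \<noteq> {}" and P': "P' \<subseteq> prob_vectors" and c: "0 \<le> c"
    and dom: "\<And>p. p \<in> P \<Longrightarrow> \<exists>q\<in>P'. (\<Sum>i\<in>UNIV. p $ i * quad x (Q i)) \<le>
                c * (\<Sum>j\<in>UNIV. q $ j * quad x (Q' j))"
  shows "dro_objective Q P x \<le> c * dro_objective Q' P' x"
  unfolding dro_objective_def[of Q]
proof (rule cSUP_least)
  fix p assume "p \<in> P"
  then obtain q where q: "q \<in> P'"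
    and le: "(\<Sum>i\<in>UNIV. p $ i * quad x (Q i)) \<le> c * (\<Sum>j\<in>UNIV. q $ j * quad x (Q' j))"
    using dom by blast
  have "(\<Sum>j\<in>UNIV. r $ j * quad x (Q' j)) \<le> (\<Sum>j\<in>UNIV. \<bar>quad x (Q' j)\<bar>)" if "r \<in> P'" for r
  proof (rule sum_mono)
    fix j
    have "0 \<le> r $ j" "r $ j \<le> 1"
      using that P' by (auto simp: prob_vectors_def)
    then have "\<bar>r $ j * quad x (Q' j)\<bar> \<le> \<bar>quad x (Q' j)\<bar>"
      by (simp add: abs_mult mult_left_le_one_le)
    then show "r $ j * quad x (Q' j) \<le> \<bar>quad x (Q' j)\<bar>"
      by linarith
  qed
  then have "bdd_above ((\<lambda>r. \<Sum>j\<in>UNIV. r $ j * quad x (Q' j)) ` P')"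
    by (rule bdd_aboveI2)
  then have "(\<Sum>j\<in>UNIV. q $ j * quad x (Q' j)) \<le> dro_objective Q' P' x"
    unfolding dro_objective_def using q by (intro cSUP_upper)
  then show "(\<Sum>i\<in>UNIV. p $ i * quad x (Q i)) \<le> c * dro_objective Q' P' x"
    using le c by (meson mult_left_mono order_trans)
qed fact

lemma clustering_sum:
  fixes S :: "'k::finite \<Rightarrow> 's::finite set" and g :: "'s \<Rightarrow> real"
  assumes "clustering S"
  shows "(\<Sum>i\<in>UNIV. g i) = (\<Sum>j\<in>UNIV. \<Sum>i\<in>S j. g i)"
proof -
  have "(\<Sum>i\<in>(\<Union>j. S j). g i) = (\<Sum>j\<in>UNIV. \<Sum>i\<in>S j. g i)"
    using assms by (intro sum.UNION_disjoint) (auto simp: clustering_def disjoint_family_on_def)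
  with assms show ?thesis
    by (simp add: clustering_def)
qed

lemma aggregated_subset_prob_vectors:
  assumes "clustering S" "P \<subseteq> prob_vectors"
  shows "aggregated S P \<subseteq> prob_vectors"
  using assms clustering_sum[OF assms(1), symmetric] by (fastforce simp: aggregated_def prob_vectors_def)

lemma aggregate_mem:
  assumes "P \<subseteq> prob_vectors" "p \<in> P"
  shows "(\<chi> j. \<Sum>i\<in>S j. p $ i) \<in> aggregated S P"
proof -
  have p: "0 \<le> p $ i" "(\<Sum>i\<in>UNIV. p $ i) = 1" for i
    using assms by (auto simp: prob_vectors_def)
  then have "(\<Sum>i\<in>S j. p $ i) \<le> 1" for j
    by (metis finite sum_mono2 subset_UNIV)
  with p assms show ?thesis
    by (auto simp: aggregated_def intro: sum_nonneg)
qed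

text \<open>
  Within a cluster the weights \<open>p\<^sub>i\<close> multiply forms comparable to the one of the representative, so
  grouping the sum by clusters turns \<open>p\<close> into its aggregate. This gives both comparisons
  pointwise in \<open>x\<close>.
\<close>

lemma admissible_guarantee:
  fixes S :: "'k::finite \<Rightarrow> 's::finite set" and Q :: "'s \<Rightarrow> real^'n^'n"
  assumes adm: "admissible Q S Qt \<alpha> \<beta>" and P: "P \<noteq> {}" "P \<subseteq> prob_vectors"
    and opt: "dro_optimal Q P X xopt" and red: "dro_optimal Qt (aggregated S P) X xred"
  shows "dro_objective Q P xred \<le> \<alpha> * \<beta> * dro_objective Q P xopt"
proof -
  have S: "clustering S"
    using admissible_imp_sandwiched[OF adm] by blast
  have pos: "\<alpha> > 0" "\<beta> > 0"
    and Q_le: "\<And>i j x. i \<in> S j \<Longrightarrow> quad x (Q i) \<le> \<alpha> * quad x (Qt j)"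
    and Qt_le: "\<And>i j x. i \<in> S j \<Longrightarrow> quad x (Qt j) \<le> \<beta> * quad x (Q i)"
    using adm by (auto simp: admissible_def dest!: loewner_le_quad bspec spec)
  have nonneg: "0 \<le> p $ i" if "p \<in> P" for p i
    using that P by (auto simp: prob_vectors_def)
  have agg_sum: "(\<Sum>j\<in>UNIV. (\<Sum>i\<in>S j. p $ i) * quad x (Qt j)) =
      (\<Sum>j\<in>UNIV. \<Sum>i\<in>S j. p $ i * quad x (Qt j))" for p x
    by (simp add: sum_distrib_right)
  have up: "dro_objective Q P x \<le> \<alpha> * dro_objective Qt (aggregated S P) x" for x
  proof (rule dro_objective_mono)
    fix p assume p: "p \<in> P"
    have "(\<Sum>i\<in>UNIV. p $ i * quad x (Q i)) \<le>
        (\<Sum>j\<in>UNIV. \<Sum>i\<in>S j. p $ i * (\<alpha> * quad x (Qt j)))"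
      unfolding clustering_sum[OF S] using nonneg[OF p] Q_le by (intro sum_mono mult_left_mono)
    also have "\<dots> = \<alpha> * (\<Sum>j\<in>UNIV. (\<chi> j. \<Sum>i\<in>S j. p $ i) $ j * quad x (Qt j))"
      by (simp add: agg_sum sum_distrib_left mult_ac)
    finally show "\<exists>q\<in>aggregated S P. (\<Sum>i\<in>UNIV. p $ i * quad x (Q i)) \<le>
        \<alpha> * (\<Sum>j\<in>UNIV. q $ j * quad x (Qt j))"
      using aggregate_mem[OF P(2) p] by blast
  qed (use P pos aggregated_subset_prob_vectors[OF S P(2)] in auto)
  have down: "dro_objective Qt (aggregated S P) x \<le> \<beta> * dro_objective Q P x" for x
  proof (rule dro_objective_mono)
    fix q assume "q \<in> aggregated S P"
    then obtain p where p: "p \<in> P" and q: "\<And>j. q $ j = (\<Sum>i\<in>S j. p $ i)"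
      by (auto simp: aggregated_def)
    have "(\<Sum>j\<in>UNIV. q $ j * quad x (Qt j)) \<le>
        (\<Sum>j\<in>UNIV. \<Sum>i\<in>S j. p $ i * (\<beta> * quad x (Q i)))"
      unfolding q agg_sum using nonneg[OF p] Qt_le by (intro sum_mono mult_left_mono)
    also have "\<dots> = \<beta> * (\<Sum>i\<in>UNIV. p $ i * quad x (Q i))"
      unfolding clustering_sum[OF S] by (simp add: sum_distrib_left mult_ac)
    finally show "\<exists>p\<in>P. (\<Sum>j\<in>UNIV. q $ j * quad x (Qt j)) \<le>
        \<beta> * (\<Sum>i\<in>UNIV. p $ i * quad x (Q i))"
      using p by blast
  next
    show "aggregated S P \<noteq> {}"
      using P aggregate_mem by blast
  qed (use P pos in auto)
  have "dro_objective Q P xred \<le> \<alpha> * dro_objective Qt (aggregated S P) xred"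
    by (rule up)
  also have "\<dots> \<le> \<alpha> * dro_objective Qt (aggregated S P) xopt"
    using opt red pos by (intro mult_left_mono) (auto simp: dro_optimal_def is_arg_min_linorder)
  also have "\<dots> \<le> \<alpha> * (\<beta> * dro_objective Q P xopt)"
    using down pos by (intro mult_left_mono) auto
  finally show ?thesis
    by (simp add: mult.assoc)
qed

theorem theorem5p1:
  fixes Q :: "'s::finite \<Rightarrow> real^'n^'n"
  assumes "\<And>i. pos_def (Q i)"
    and "CARD('k::finite) \<le> CARD('s)"
  shows
    "(\<exists>M0>0. \<forall>M\<ge>M0.
       (\<exists>v. is_minimum {\<alpha> * \<beta> |\<alpha> \<beta> (Qt :: 'k \<Rightarrow> real^'n^'n) z. program_feasible Q M \<alpha> \<beta> Qt z} v \<and>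
            is_minimum {\<alpha> * \<beta> |\<alpha> \<beta> (Qt :: 'k \<Rightarrow> real^'n^'n) S. admissible Q S Qt \<alpha> \<beta>} v) \<and>
       (\<forall>\<alpha> \<beta> (Qt :: 'k \<Rightarrow> real^'n^'n) z. program_optimal Q M \<alpha> \<beta> Qt z \<longrightarrow>
          admissible Q (\<lambda>j. {i. z i j = 1}) Qt \<alpha> \<beta> \<and>
          is_minimum {\<alpha>' * \<beta>' |\<alpha>' \<beta>' (Qt' :: 'k \<Rightarrow> real^'n^'n) S'. admissible Q S' Qt' \<alpha>' \<beta>'} (\<alpha> * \<beta>))) \<and>
     (\<forall>(S :: 'k \<Rightarrow> 's set) Qt \<alpha> \<beta>. admissible Q S Qt \<alpha> \<beta> \<longrightarrow>
        (\<forall>(X :: (real^'n) set) (P :: (real^'s) set) xopt xred.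
           P \<noteq> {} \<and> P \<subseteq> prob_vectors \<and>
           dro_optimal Q P X xopt \<and> dro_optimal Qt (aggregated S P) X xred \<longrightarrow>
           dro_objective Q P xred \<le> \<alpha> * \<beta> * dro_objective Q P xopt))"
proof (rule conjI)
  let ?Adm = "{\<alpha> * \<beta> |\<alpha> \<beta> (Qt :: 'k \<Rightarrow> real^'n^'n) S. admissible Q S Qt \<alpha> \<beta>}"
  note Q = assms(1)
  obtain v S and R :: "'k \<Rightarrow> real^'n^'n" where R: "sandwiched Q S R v" and S: "clustering S"
    and vmin: "is_minimum ?Adm v"
    by (rule admissible_minimum_exists[OF assms])
  obtain c where c: "c > 0" "\<And>i. Q i \<preceq>\<^sub>L c *\<^sub>R mat 1"
    using uniform_spectral_bounds[of Q, OF Q] by metis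
  have v: "v > 0"
    using sandwiched_value_pos[OF R _ Q] S by (auto simp: clustering_def)
  show "\<exists>M0>0. \<forall>M\<ge>M0.
       (\<exists>v. is_minimum {\<alpha> * \<beta> |\<alpha> \<beta> (Qt :: 'k \<Rightarrow> real^'n^'n) z. program_feasible Q M \<alpha> \<beta> Qt z} v \<and>
            is_minimum {\<alpha> * \<beta> |\<alpha> \<beta> (Qt :: 'k \<Rightarrow> real^'n^'n) S. admissible Q S Qt \<alpha> \<beta>} v) \<and>
       (\<forall>\<alpha> \<beta> (Qt :: 'k \<Rightarrow> real^'n^'n) z. program_optimal Q M \<alpha> \<beta> Qt z \<longrightarrow>
          admissible Q (\<lambda>j. {i. z i j = 1}) Qt \<alpha> \<beta> \<and>
          is_minimum {\<alpha>' * \<beta>' |\<alpha>' \<beta>' (Qt' :: 'k \<Rightarrow> real^'n^'n) S'. admissible Q S' Qt' \<alpha>' \<beta>'} (\<alpha> * \<beta>))"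
  proof (rule exI[of _ "c + v * c"], intro conjI allI impI)
    show "0 < c + v * c"
      using c v by (simp add: add_pos_pos)
  next
    fix M assume M: "c + v * c \<le> M"
    let ?Prog = "{\<alpha> * \<beta> |\<alpha> \<beta> (Qt :: 'k \<Rightarrow> real^'n^'n) z. program_feasible Q M \<alpha> \<beta> Qt z}"
    have "c \<le> M" "v * c \<le> M"
      using M c v by (smt (verit) mult_pos_pos)+
    moreover have "v *\<^sub>R Q i \<preceq>\<^sub>L (v * c) *\<^sub>R mat 1" for i
      using loewner_le_scaleR[OF _ c(2), of v] v by simp
    ultimately have "Q i \<preceq>\<^sub>L M *\<^sub>R mat 1" "v *\<^sub>R Q i \<preceq>\<^sub>L M *\<^sub>R mat 1" for i
      using c(2) loewner_le_scaleR_mono pos_semidef_mat_1 by blast+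
    then have feas: "program_feasible Q M 1 v R (\<lambda>i j. of_bool (i \<in> S j))"
      by (rule normalized_feasible[OF Q R S])
    have sub: "?Prog \<subseteq> ?Adm"
      using program_feasible_imp_admissible[of Q, OF Q] by blast
    have "v \<in> ?Prog"
      using feas by (metis (mono_tags, lifting) mem_Collect_eq mult_1)
    with sub vmin have "is_minimum ?Prog v"
      unfolding is_minimum_def by blast
    with vmin show "\<exists>v. is_minimum ?Prog v \<and> is_minimum ?Adm v"
      by blast
    fix \<alpha> \<beta> z and Qt :: "'k \<Rightarrow> real^'n^'n"
    assume opt: "program_optimal Q M \<alpha> \<beta> Qt z"
    then have f: "program_feasible Q M \<alpha> \<beta> Qt z"
      by (simp add: program_optimal_def is_arg_min_def)
    then show adm: "admissible Q (\<lambda>j. {i. z i j = 1}) Qt \<alpha> \<beta>"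
      by (rule program_feasible_imp_admissible[OF Q])
    have "\<alpha> * \<beta> \<le> v"
      using opt feas unfolding program_optimal_def is_arg_min_linorder by fastforce
    moreover have "\<alpha> * \<beta> \<in> ?Adm"
      using adm by blast
    ultimately show "is_minimum ?Adm (\<alpha> * \<beta>)"
      using vmin unfolding is_minimum_def by (meson order_trans)
  qed
next
  show "\<forall>(S :: 'k \<Rightarrow> 's set) Qt \<alpha> \<beta>. admissible Q S Qt \<alpha> \<beta> \<longrightarrow>
        (\<forall>(X :: (real^'n) set) (P :: (real^'s) set) xopt xred.
           P \<noteq> {} \<and> P \<subseteq> prob_vectors \<and>
           dro_optimal Q P X xopt \<and> dro_optimal Qt (aggregated S P) X xred \<longrightarrow>
           dro_objective Q P xred \<le> \<alpha> * \<beta> * dro_objective Q P xopt)"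
    using admissible_guarantee by blast
qed

end
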